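(* Let $\alpha_0,\alpha_1,\alpha_2,\beta_0,\beta_1,\beta_2$ be $6$ arbitrary parameters, and assume that the $9$ coefficients $c_m$ of the monic polynomial $P_9(z)=z^9+\sum_{m=0}^{8}c_m z^m$ are expressed as follows in terms of them: $$c_0=\alpha_0\left[\beta_1+\alpha_0(\alpha_0+\beta_2)\right]+\beta_0,$$ $$c_1=\alpha_0\alpha_1(3\alpha_0+2\beta_2)+\alpha_1\beta_1,$$ $$c_2=3\alpha_0\left[\alpha_1^2+\alpha_0\alpha_2\right]+\beta_2\left[\alpha_1^2+2\alpha_0\alpha_2\right]+\alpha_2\beta_1,$$ $$c_3=3\alpha_0(\alpha_0+2\alpha_1\alpha_2)+2\beta_2(\alpha_0+\alpha_1\alpha_2)+\alpha_1^3+\beta_1,$$ $$c_4=3\alpha_0\left[2\alpha_1+\alpha_2^2\right]+3\alpha_1^2\alpha_2+\left[2\alpha_1+\alpha_2^2\right]\beta_2,$$ $$c_5=3\alpha_1\left[\alpha_1+\alpha_2^2\right]+2\alpha_2(3\alpha_0+\beta_2),$$ $$c_6=3\alpha_0+\alpha_2\left[6\alpha_1+\alpha_2^2\right]+\beta_2,$$ $$c_7=3\left[\alpha_1+\alpha_2^2\right],$$ $$c_8=3\alpha_2.$$ Then the $9$ roots of $P_9$ are the $9$ numbers $z_{\lambda\mu}$ ($\lambda=1,2,3$, $\mu=1,2,3$) defined as follows in terms of the $6$ parameters: for each $\mu\in\{1,2,3\}$, the numbers $z_{1\mu},z_{2\mu},z_{3\mu}$ are the $3$ roots of the cubic equation in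 $z$ $$z^3+\alpha_2z^2+\alpha_1z+\alpha_0=y_\mu,$$ where $y_1,y_2,y_3$ are the $3$ roots of the cubic equation in $y$ $$y^3+\beta_2y^2+\beta_1y+\beta_0=0.$$
   Context: All parameters, coefficients and roots are complex numbers, and roots are counted with multiplicity: the $N$ zeros $z_n$ of a monic polynomial $P_N$ of degree $N$ are the numbers such that $P_N(z)=\prod_{n=1}^{N}(z-z_n)=z^N+\sum_{m=0}^{N-1}c_m z^m$. Here $N=9$. *)

theory Defs
  imports Complex_Main "HOL-Computational_Algebra.Polynomial"
begin

text \<open>Repetitions in the family encode multiplicities. For finite \<open>I\<close> the identity
  forces \<open>p\<close> to be monic of degree \<open>card I\<close>.\<close>

definition zeros_are :: "complex poly \<Rightarrow> 'i set \<Rightarrow> ('i \<Rightarrow> complex) \<Rightarrow> bool" where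
  "zeros_are p I z \<longleftrightarrow> finite I \<and> (\<forall>x. poly p x = (\<Prod>i\<in>I. x - z i))"

definition monic_poly :: "nat \<Rightarrow> (nat \<Rightarrow> complex) \<Rightarrow> complex poly" where
  "monic_poly N c = monom 1 N + (\<Sum>m<N. monom (c m) m)"

end

theory Submission
  imports Defs
begin

text \<open>The nine coefficients are those of the composition \<open>q (p z)\<close>, where
  \<open>q = y\<^sup>3 + \<beta>2 y\<^sup>2 + \<beta>1 y + \<beta>0\<close> and
  \<open>p = z\<^sup>3 + \<alpha>2 z\<^sup>2 + \<alpha>1 z + \<alpha>0\<close>. Factoring \<open>q\<close> over its zeros
  \<open>y \<mu>\<close> turns the composition into the product of the cubics \<open>p z - y \<mu>\<close>, and
  factoring each of those gives all nine linear factors (lemma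
  \<open>zeros_are_pcompose\<close>).\<close>

text \<open>Multiplicities are carried along automatically, because the argument multiplies
  factorizations and never speaks of individual zeros.\<close>

lemma zeros_are_pcompose:
  assumes q: "zeros_are q J y"
    and p: "\<And>j. j \<in> J \<Longrightarrow> zeros_are (p - [:y j:]) I (\<lambda>i. z i j)"
    and "finite I"
  shows "zeros_are (pcompose q p) (I \<times> J) (\<lambda>(i, j). z i j)"
proof -
  have "poly (pcompose q p) x = (\<Prod>(i, j)\<in>I \<times> J. x - z i j)" for x
  proof -
    have "poly (pcompose q p) x = (\<Prod>j\<in>J. poly p x - y j)"
      using q by (simp add: zeros_are_def poly_pcompose)
    also have "\<dots> = (\<Prod>j\<in>J. \<Prod>i\<in>I. x - z i j)"
      using p by (intro prod.cong) (simp_all add: zeros_are_def)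
    also have "\<dots> = (\<Prod>i\<in>I. \<Prod>j\<in>J. x - z i j)"
      by (rule prod.swap)
    also have "\<dots> = (\<Prod>(i, j)\<in>I \<times> J. x - z i j)"
      by (rule prod.cartesian_product)
    finally show ?thesis .
  qed
  with q \<open>finite I\<close> show ?thesis
    by (simp add: zeros_are_def case_prod_unfold)
qed

lemma poly_monic_poly: "poly (monic_poly N c) x = x ^ N + (\<Sum>m<N. c m * x ^ m)"
  by (simp add: monic_poly_def poly_monom poly_sum)

theorem mainTheorem3:
  fixes \<alpha>0 \<alpha>1 \<alpha>2 \<beta>0 \<beta>1 \<beta>2 :: complex
    and c :: "nat \<Rightarrow> complex"
    and y :: "nat \<Rightarrow> complex"
    and z :: "nat \<Rightarrow> nat \<Rightarrow> complex"
  assumes c0: "c 0 = \<alpha>0 * (\<beta>1 + \<alpha>0 * (\<alpha>0 + \<beta>2)) + \<beta>0"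
    and c1: "c 1 = \<alpha>0 * \<alpha>1 * (3 * \<alpha>0 + 2 * \<beta>2) + \<alpha>1 * \<beta>1"
    and c2: "c 2 = 3 * \<alpha>0 * (\<alpha>1^2 + \<alpha>0 * \<alpha>2) + \<beta>2 * (\<alpha>1^2 + 2 * \<alpha>0 * \<alpha>2) + \<alpha>2 * \<beta>1"
    and c3: "c 3 = 3 * \<alpha>0 * (\<alpha>0 + 2 * \<alpha>1 * \<alpha>2) + 2 * \<beta>2 * (\<alpha>0 + \<alpha>1 * \<alpha>2) + \<alpha>1^3 + \<beta>1"
    and c4: "c 4 = 3 * \<alpha>0 * (2 * \<alpha>1 + \<alpha>2^2) + 3 * \<alpha>1^2 * \<alpha>2 + (2 * \<alpha>1 + \<alpha>2^2) * \<beta>2"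
    and c5: "c 5 = 3 * \<alpha>1 * (\<alpha>1 + \<alpha>2^2) + 2 * \<alpha>2 * (3 * \<alpha>0 + \<beta>2)"
    and c6: "c 6 = 3 * \<alpha>0 + \<alpha>2 * (6 * \<alpha>1 + \<alpha>2^2) + \<beta>2"
    and c7: "c 7 = 3 * (\<alpha>1 + \<alpha>2^2)"
    and c8: "c 8 = 3 * \<alpha>2"
    and y: "zeros_are [:\<beta>0, \<beta>1, \<beta>2, 1:] {1..3} y"
    and z: "\<And>\<mu>. \<mu> \<in> {1..3} \<Longrightarrow>
      zeros_are ([:\<alpha>0, \<alpha>1, \<alpha>2, 1:] - [:y \<mu>:]) {1..3} (\<lambda>l. z l \<mu>)"
  shows "zeros_are (monic_poly 9 c) ({1..3} \<times> {1..3}) (\<lambda>(l, \<mu>). z l \<mu>)"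
proof -
  let ?p = "[:\<alpha>0, \<alpha>1, \<alpha>2, 1:]" and ?q = "[:\<beta>0, \<beta>1, \<beta>2, 1:]"
  have "poly (monic_poly 9 c) x = poly (pcompose ?q ?p) x" for x
  proof -
    have "poly (monic_poly 9 c) x = x^9 + (c 0 + c 1 * x + c 2 * x^2 + c 3 * x^3
        + c 4 * x^4 + c 5 * x^5 + c 6 * x^6 + c 7 * x^7 + c 8 * x^8)"
      by (simp add: poly_monic_poly eval_nat_numeral)
    also have "\<dots> = poly ?q (poly ?p x)"
      unfolding c0 c1 c2 c3 c4 c5 c6 c7 c8 by simp algebra
    finally show ?thesis
      by (simp only: poly_pcompose)
  qed
  moreover have "zeros_are (pcompose ?q ?p) ({1..3} \<times> {1..3}) (\<lambda>(l, \<mu>). z l \<mu>)"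
    using y z by (rule zeros_are_pcompose) simp_all
  ultimately show ?thesis
    by (simp add: zeros_are_def)
qed

end
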